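(* Let $b\ge2$ be an integer and $c>1$ real such that $\alpha=\log_b c$ is irrational, and fix an integer $h\ge1$. Put $\beta_h=\{h\alpha\}\in(0,1)$ and $t_{h,k}=b^{\beta_h+k}$ for integers $k\ge0$. If $m,m+h\in\mathcal S_{c,b}$, write $j_u=\lfloor F_{c,b}(u)\rfloor$ for $u=m,m+h$. Then $$k=h\alpha-(j_{m+h}-j_m)-\beta_h$$ is a nonnegative integer and satisfies $t_{h,k}<h+2$ and $$\frac{h-t_{h,k}}{t_{h,k}-1}<m<\frac{h+1}{t_{h,k}-1}.$$ The real length of this open interval (shell) is exactly $$W_{h,k}=\frac{t_{h,k}+1}{t_{h,k}-1}=1+\frac2{t_{h,k}-1}.$$ If, in addition, $h\le(b-1)m-1$, then necessarily $k=0$, and hence $$\frac{h-b^{\beta_h}}{b^{\beta_h}-1}<m<\frac{h+1}{b^{\beta_h}-1}.$$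
   Context: $\mathcal S_{c,b}$ is the set of integers $m\ge1$ for which there is an integer $k\ge0$ with $mb^k\le c^m<(m+1)b^k$. $F_{c,b}(m)=m\log_b c-\log_b m$ and $\{x\}=x-\lfloor x\rfloor$. *)

theory Defs
  imports "HOL-Analysis.Analysis"
begin

definition S_set :: "real \<Rightarrow> nat \<Rightarrow> nat set" where
  "S_set c b = {m. m \<ge> 1 \<and>
     (\<exists>k::nat. real m * real b ^ k \<le> c ^ m \<and> c ^ m < (real m + 1) * real b ^ k)}"

definition F :: "real \<Rightarrow> nat \<Rightarrow> nat \<Rightarrow> real" where
  "F c b m = real m * log (real b) c - log (real b) (real m)"

definition beta :: "real \<Rightarrow> nat \<Rightarrow> nat \<Rightarrow> real" where
  "beta c b h = frac (real h * log (real b) c)"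

definition t :: "real \<Rightarrow> nat \<Rightarrow> nat \<Rightarrow> nat \<Rightarrow> real" where
  "t c b h k = real b powr (beta c b h + real k)"

definition shell :: "real \<Rightarrow> nat \<Rightarrow> nat \<Rightarrow> nat \<Rightarrow> real set" where
  "shell c b h k =
     {(real h - t c b h k) / (t c b h k - 1) <..< (real h + 1) / (t c b h k - 1)}"

definition W :: "real \<Rightarrow> nat \<Rightarrow> nat \<Rightarrow> nat \<Rightarrow> real" where
  "W c b h k = (t c b h k + 1) / (t c b h k - 1)"

end

theory Submission
  imports Defs
begin

text \<open>
  Membership of \<open>m\<close> in \<open>S_set c b\<close> says that \<open>c ^ m / b ^ j\<close> lies in \<open>[m, m + 1)\<close> for some
  \<open>j\<close>. Since \<open>(m + 1) / m \<le> 2 \<le> b\<close>, this \<open>j\<close> is \<open>\<lfloor>F c b m\<rfloor>\<close>. For two members \<open>m\<close> and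
  \<open>m + h\<close>, dividing the two normalised powers leaves \<open>c ^ h = b powr (h * \<alpha>)\<close> times a power of
  \<open>b\<close>, so \<open>b powr (h * \<alpha> - (j' - j))\<close> is a quotient of an element of \<open>[m + h, m + h + 1)\<close> by one of
  \<open>[m, m + 1)\<close> (lemma \<open>S_set_quotient_bounds\<close>). Such a quotient exceeds \<open>(m + h) / (m + 1) \<ge> 1\<close>
  and is below \<open>(m + h + 1) / m\<close>.

  The exponent \<open>K = h * \<alpha> - (j' - j)\<close> differs from \<open>h * \<alpha>\<close> by an integer, so its fractional part
  is \<open>beta c b h\<close> and \<open>k = \<lfloor>K\<rfloor>\<close>; the quotient is therefore \<open>t c b h k\<close>. That it is larger than
  \<open>1\<close> gives \<open>k \<ge> 0\<close>, and solving the two quotient bounds for \<open>m\<close> gives the shell. If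
  \<open>m + h + 1 \<le> b * m\<close>, the quotient is below \<open>b\<close>, which forces \<open>K < 1\<close>.
\<close>

text \<open>
  The quantity \<open>b powr F c b m\<close> is \<open>c ^ m / m\<close>, so the defining inequalities pin \<open>F c b m\<close> to
  an interval \<open>[k, k + log b ((m + 1) / m))\<close>, of length at most \<open>1\<close>.
\<close>

lemma S_set_floor_F_bounds:
  assumes "b \<ge> 2" "c > 1" "m \<in> S_set c b"
  shows "real m * real b powr real_of_int \<lfloor>F c b m\<rfloor> \<le> c ^ m"
    and "c ^ m < (real m + 1) * real b powr real_of_int \<lfloor>F c b m\<rfloor>"
proof -
  from assms(3) obtain k :: nat where m: "m \<ge> 1"
    and lo: "real m * real b ^ k \<le> c ^ m" and hi: "c ^ m < (real m + 1) * real b ^ k"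
    by (auto simp: S_set_def)
  have b: "real b > 1" and c: "c > 0" using assms by auto
  have F: "F c b m = log (real b) (c ^ m / real m)"
    using b c m by (simp add: F_def log_divide log_nat_power)
  have "real b powr real k \<le> c ^ m / real m"
    using lo b m by (simp add: powr_realpow field_simps)
  then have "real k \<le> F c b m"
    unfolding F using b c m by (subst le_log_iff) auto
  moreover have "c ^ m / real m < real b powr (real k + 1)"
  proof -
    \<comment> \<open>Here \<open>b \<ge> 2\<close> enters: it keeps the whole window \<open>[m, m + 1)\<close> below \<open>b * m\<close>.\<close>
    have "real m + 1 \<le> 2 * real m" using m by simp
    also have "\<dots> \<le> real b * real m"
      using assms(1) by (intro mult_right_mono) auto
    finally have "real m + 1 \<le> real b * real m" .
    then have "(real m + 1) * real b ^ k \<le> (real b * real m) * real b ^ k"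
      using b by (intro mult_right_mono) auto
    with hi have "c ^ m < (real b * real m) * real b ^ k" by linarith
    then show ?thesis
      using b m by (simp add: powr_add powr_realpow field_simps)
  qed
  then have "F c b m < real k + 1"
    unfolding F using b c m by (subst log_less_iff) auto
  ultimately have "\<lfloor>F c b m\<rfloor> = int k" by (intro floor_unique) auto
  then show "real m * real b powr real_of_int \<lfloor>F c b m\<rfloor> \<le> c ^ m"
    and "c ^ m < (real m + 1) * real b powr real_of_int \<lfloor>F c b m\<rfloor>"
    using lo hi b by (simp_all add: powr_realpow)
qed

text \<open>
  In terms of the window positions \<open>x = c ^ m / b powr j\<close> and
  \<open>y = c ^ (m + h) / b powr j'\<close>, the power of \<open>b\<close> below equals \<open>y / x\<close>. Because \<open>x < m + 1\<close> and
  \<open>y < m + h + 1\<close> are strict, so are both bounds.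
\<close>

lemma S_set_quotient_bounds:
  fixes b h m :: nat and c :: real
  assumes "b \<ge> 2" "c > 1" "m \<in> S_set c b" "m + h \<in> S_set c b"
  defines "K \<equiv> real h * log (real b) c - real_of_int (\<lfloor>F c b (m + h)\<rfloor> - \<lfloor>F c b m\<rfloor>)"
  shows "real m + real h < (real m + 1) * real b powr K"
    and "real m * real b powr K < real m + real h + 1"
proof -
  define x where "x = c ^ m / real b powr real_of_int \<lfloor>F c b m\<rfloor>"
  define y where "y = c ^ (m + h) / real b powr real_of_int \<lfloor>F c b (m + h)\<rfloor>"
  have b: "real b > 1" and c: "c > 0" using assms by auto
  have m: "m \<ge> 1" using assms(3) by (simp add: S_set_def)
  have x: "real m \<le> x" "x < real m + 1"
    using S_set_floor_F_bounds[OF assms(1,2,3)] b by (auto simp: x_def field_simps)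
  have y: "real m + real h \<le> y" "y < real m + real h + 1"
    using S_set_floor_F_bounds[OF assms(1,2,4)] b by (auto simp: y_def field_simps)
  have "real b powr (real h * log (real b) c) = c ^ h"
    using b c by (simp add: log_nat_power[symmetric])
  then have xy: "x * real b powr K = y"
    using b by (simp add: K_def x_def y_def powr_diff powr_add power_add field_simps)
  have pos: "real b powr K > 0" using b by simp
  have "x * real b powr K < (real m + 1) * real b powr K"
    using x pos by simp
  with xy y show "real m + real h < (real m + 1) * real b powr K" by linarith
  have "real m * real b powr K \<le> x * real b powr K"
    using x pos by simp
  with xy y show "real m * real b powr K < real m + real h + 1" by linarith
qed

lemma beta_in_unit_interval:
  assumes "log (real b) c \<notin> \<rat>" "h \<ge> 1"
  shows "beta c b h \<in> {0<..<1}"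
proof -
  have "real h * log (real b) c \<notin> \<int>"
  proof
    assume "real h * log (real b) c \<in> \<int>"
    then have "real h * log (real b) c / real h \<in> \<rat>"
      by (intro Rats_divide) (auto simp: Ints_def)
    with assms show False by simp
  qed
  then show ?thesis
    by (simp add: beta_def frac_lt_1)
qed

lemma W_eq:
  assumes "t c b h k > 1"
  shows "W c b h k = 1 + 2 / (t c b h k - 1)"
  using assms by (simp add: W_def field_simps)

lemma measure_shell:
  assumes "t c b h k > 1"
  shows "measure lborel (shell c b h k) = W c b h k"
proof -
  have "(real h - t c b h k) / (t c b h k - 1) \<le> (real h + 1) / (t c b h k - 1)"
    using assms by (intro divide_right_mono) auto
  then show ?thesis
    by (simp add: shell_def W_def diff_divide_distrib[symmetric])
qed

theorem theorem5p13:
  fixes b h :: nat and c \<alpha> :: real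
  assumes "b \<ge> 2" and "c > 1"
    and "\<alpha> = log (real b) c" and "\<alpha> \<notin> \<rat>"
    and "h \<ge> 1"
  shows "beta c b h \<in> {0<..<1} \<and>
    (\<forall>m. m \<in> S_set c b \<longrightarrow> m + h \<in> S_set c b \<longrightarrow>
      (\<exists>k::nat.
         real k = real h * \<alpha> - real_of_int (\<lfloor>F c b (m + h)\<rfloor> - \<lfloor>F c b m\<rfloor>) - beta c b h \<and>
         t c b h k < real h + 2 \<and>
         real m \<in> shell c b h k \<and>
         measure lborel (shell c b h k) = W c b h k \<and>
         W c b h k = 1 + 2 / (t c b h k - 1) \<and>
         (int h \<le> (int b - 1) * int m - 1 \<longrightarrow>
            k = 0 \<and>
            (real h - real b powr beta c b h) / (real b powr beta c b h - 1) < real m \<and>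
            real m < (real h + 1) / (real b powr beta c b h - 1))))"
proof (intro conjI allI impI)
  show beta: "beta c b h \<in> {0<..<1}"
    using beta_in_unit_interval assms by blast
  fix m
  assume mS: "m \<in> S_set c b" and mhS: "m + h \<in> S_set c b"
  define d where "d = \<lfloor>F c b (m + h)\<rfloor> - \<lfloor>F c b m\<rfloor>"
  define K where "K = real h * \<alpha> - real_of_int d"
  have b: "real b > 1" using assms(1) by simp
  have m: "m \<ge> 1" using mS by (simp add: S_set_def)
  have lo: "real m + real h < (real m + 1) * real b powr K"
    and hi: "real m * real b powr K < real m + real h + 1"
    using S_set_quotient_bounds[OF assms(1,2) mS mhS] by (simp_all add: K_def d_def assms(3))
  have gt1: "real b powr K > 1"
  proof (rule ccontr)
    assume "\<not> real b powr K > 1"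
    then have "(real m + 1) * real b powr K \<le> real m + 1"
      by (intro mult_left_le) auto
    with lo have "real h < 1" by linarith
    with assms(5) show False by simp
  qed
  then have "real b powr 0 < real b powr K" using b by simp
  then have K_pos: "K > 0" using b by (subst (asm) powr_less_cancel_iff) auto
  define k where "k = nat \<lfloor>K\<rfloor>"
  have "frac K = beta c b h"
    by (simp add: K_def beta_def assms(3) frac_def)
  then have k: "real k = K - beta c b h"
    using K_pos by (simp add: k_def frac_def)
  then have t: "t c b h k = real b powr K" by (simp add: t_def)
  have "real m * real b powr K < real m * (real h + 2)"
  proof -
    have "real h + 1 \<le> real m * (real h + 1)"
      using m mult_right_mono[of 1 "real m" "real h + 1"] by simp
    with hi show ?thesis by (simp add: algebra_simps)
  qed
  then have t_lt: "t c b h k < real h + 2" using m t by simp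
  have shell: "real m \<in> shell c b h k"
    using lo hi gt1 by (simp add: shell_def t field_simps)
  have k0: "k = 0" if "int h \<le> (int b - 1) * int m - 1"
  proof -
    have "int (m + h + 1) \<le> int (b * m)"
      using that by (simp add: algebra_simps)
    then have "m + h + 1 \<le> b * m" by (simp only: of_nat_le_iff)
    then have "real (m + h + 1) \<le> real (b * m)" by (simp only: of_nat_le_iff)
    with hi have "real m * real b powr K < real m * real b"
      by (simp add: mult.commute)
    then have "real b powr K < real b powr 1" using b m by simp
    then have "K < 1" using b by (subst (asm) powr_less_cancel_iff) auto
    then show ?thesis using k beta by simp
  qed
  show "\<exists>k::nat.
         real k = real h * \<alpha> - real_of_int (\<lfloor>F c b (m + h)\<rfloor> - \<lfloor>F c b m\<rfloor>) - beta c b h \<and>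
         t c b h k < real h + 2 \<and>
         real m \<in> shell c b h k \<and>
         measure lborel (shell c b h k) = W c b h k \<and>
         W c b h k = 1 + 2 / (t c b h k - 1) \<and>
         (int h \<le> (int b - 1) * int m - 1 \<longrightarrow>
            k = 0 \<and>
            (real h - real b powr beta c b h) / (real b powr beta c b h - 1) < real m \<and>
            real m < (real h + 1) / (real b powr beta c b h - 1))"
  proof (intro exI[of _ k] conjI impI)
    show "real k = real h * \<alpha> - real_of_int (\<lfloor>F c b (m + h)\<rfloor> - \<lfloor>F c b m\<rfloor>) - beta c b h"
      using k by (simp add: K_def d_def)
    show "measure lborel (shell c b h k) = W c b h k"
      and "W c b h k = 1 + 2 / (t c b h k - 1)"
      using gt1 t by (simp_all add: measure_shell W_eq)
    assume "int h \<le> (int b - 1) * int m - 1"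
    then show "k = 0" by (rule k0)
    then show "(real h - real b powr beta c b h) / (real b powr beta c b h - 1) < real m"
      and "real m < (real h + 1) / (real b powr beta c b h - 1)"
      using shell by (simp_all add: shell_def t_def)
  qed (fact t_lt shell)+
qed

end
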